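(* There exist infinitely many pairwise nonequivalent sets $\{a,b,c,d\}$ of four distinct nonzero integers for which there are distinct nonzero perfect squares $n_1 \neq n_2$ such that $\{a,b,c,d\}$ is simultaneously a regular $D(n_1)$-quadruple and a regular $D(n_2)$-quadruple. Moreover, such infinitely many pairwise nonequivalent sets can be chosen so that all four elements $a,b,c,d$ are perfect squares, so that each of these sets is also a $D(0)$-quadruple.
   Context: For an integer $n$, a set of $m$ distinct nonzero integers $\{a_1,\dots,a_m\}$ is called a $D(n)$-$m$-tuple (a $D(n)$-quadruple when $m=4$) if $a_ia_j+n$ is a perfect square (of an integer) for all $1\le i<j\le m$; the case $n=0$ is allowed. A $D(n)$-quadruple $\{a,b,c,d\}$ is called regular if $n(d+c-a-b)^2 = 4(ab+n)(cd+n)$ (this condition is symmetric in $a,b,c,d$). A quadruple $\{a,b,c,d\}$ with the properties $D(n_1)$ and $D(n_2)$ is called equivalent to the quadruple $\{au,bu,cu,du\}$ with the properties $D(n_1u^2)$ and $D(n_2u^2)$, for any nonzero rational $u$. *)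

theory Defs
  imports Complex_Main "HOL-Computational_Algebra.Nth_Powers"
begin

definition D_tuple :: "int \<Rightarrow> nat \<Rightarrow> int set \<Rightarrow> bool" where
  "D_tuple n m A \<longleftrightarrow>
     finite A \<and> card A = m \<and> 0 \<notin> A \<and> (\<forall>a\<in>A. \<forall>b\<in>A. a \<noteq> b \<longrightarrow> is_square (a * b + n))"

abbreviation D_quadruple :: "int \<Rightarrow> int set \<Rightarrow> bool" where
  "D_quadruple n A \<equiv> D_tuple n 4 A"

definition regular_eq :: "int \<Rightarrow> int \<Rightarrow> int \<Rightarrow> int \<Rightarrow> int \<Rightarrow> bool" where
  "regular_eq n a b c d \<longleftrightarrow> n * (d + c - a - b)\<^sup>2 = 4 * (a * b + n) * (c * d + n)"

text \<open>The choice of enumeration does not matter, see \<open>regular_D_quadruple_iff\<close> below.\<close>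

definition regular_D_quadruple :: "int \<Rightarrow> int set \<Rightarrow> bool" where
  "regular_D_quadruple n A \<longleftrightarrow>
     D_quadruple n A \<and> (\<exists>a b c d. A = {a, b, c, d} \<and> regular_eq n a b c d)"

lemma regular_eq_iff_sums:
  assumes "card {a, b, c, d} = 4"
  shows "regular_eq n a b c d \<longleftrightarrow>
    n * (2 * (\<Sum>x\<in>{a, b, c, d}. x\<^sup>2) - (\<Sum>{a, b, c, d})\<^sup>2) = 4 * (\<Prod>{a, b, c, d} + n\<^sup>2)"
proof -
  have "a \<noteq> b" "a \<noteq> c" "a \<noteq> d" "b \<noteq> c" "b \<noteq> d" "c \<noteq> d"
    using assms by (auto simp: card_insert_if split: if_splits)
  then have sums: "(\<Sum>x\<in>{a, b, c, d}. x\<^sup>2) = a\<^sup>2 + b\<^sup>2 + c\<^sup>2 + d\<^sup>2"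
    "\<Sum>{a, b, c, d} = a + b + c + d" "\<Prod>{a, b, c, d} = a * b * c * d"
    by (simp_all add: algebra_simps)
  have "n * (d + c - a - b)\<^sup>2 - 4 * (a * b + n) * (c * d + n) =
    n * (2 * (a\<^sup>2 + b\<^sup>2 + c\<^sup>2 + d\<^sup>2) - (a + b + c + d)\<^sup>2) - 4 * (a * b * c * d + n\<^sup>2)"
    by (simp add: power2_eq_square algebra_simps)
  then show ?thesis
    unfolding regular_eq_def sums by linarith
qed

lemma regular_D_quadruple_iff:
  assumes "D_quadruple n {a, b, c, d}"
  shows "regular_D_quadruple n {a, b, c, d} \<longleftrightarrow> regular_eq n a b c d"
proof -
  have card: "card {a, b, c, d} = 4"
    using assms by (simp add: D_tuple_def)
  show ?thesis
  proof
    assume "regular_D_quadruple n {a, b, c, d}"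
    then obtain p q r s where eq: "{a, b, c, d} = {p, q, r, s}" and reg: "regular_eq n p q r s"
      unfolding regular_D_quadruple_def by blast
    show "regular_eq n a b c d"
      using reg card regular_eq_iff_sums[of p q r s n] regular_eq_iff_sums[of a b c d n]
      unfolding eq by simp
  qed (use assms regular_D_quadruple_def in blast)
qed

definition doubly_regular :: "int set \<Rightarrow> int \<Rightarrow> int \<Rightarrow> bool" where
  "doubly_regular A n1 n2 \<longleftrightarrow>
     n1 \<noteq> 0 \<and> is_square n1 \<and> n2 \<noteq> 0 \<and> is_square n2 \<and> n1 \<noteq> n2 \<and>
     regular_D_quadruple n1 A \<and> regular_D_quadruple n2 A"

text \<open>
  A quadruple \<open>A\<close> with the properties \<open>D(n1)\<close>, \<open>D(n2)\<close> is equivalent to \<open>B\<close> with the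
  properties \<open>D(m1)\<close>, \<open>D(m2)\<close>.
\<close>

definition equivalent :: "int set \<Rightarrow> int \<Rightarrow> int \<Rightarrow> int set \<Rightarrow> int \<Rightarrow> int \<Rightarrow> bool" where
  "equivalent A n1 n2 B m1 m2 \<longleftrightarrow>
     D_quadruple n1 A \<and> D_quadruple n2 A \<and> D_quadruple m1 B \<and> D_quadruple m2 B \<and>
     (\<exists>u::rat. u \<noteq> 0 \<and> rat_of_int ` B = (\<lambda>a. rat_of_int a * u) ` A \<and>
        rat_of_int m1 = rat_of_int n1 * u\<^sup>2 \<and> rat_of_int m2 = rat_of_int n2 * u\<^sup>2)"

text \<open>
  A set can be doubly regular for at most one unordered pair \<open>{n1, n2}\<close>, because the
  regularity condition is quadratic in \<open>n\<close>. Quantifying over all admissible pairs below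
  only ensures that neither their order nor any choice of them matters.
\<close>

definition pairwise_nonequivalent :: "int set set \<Rightarrow> bool" where
  "pairwise_nonequivalent S \<longleftrightarrow>
     (\<forall>A\<in>S. \<forall>B\<in>S. A \<noteq> B \<longrightarrow>
        (\<forall>n1 n2 m1 m2. doubly_regular A n1 n2 \<longrightarrow> doubly_regular B m1 m2 \<longrightarrow>
           \<not> equivalent A n1 n2 B m1 m2))"

end

theory Submission
  imports Defs "HOL-Number_Theory.Cong"
begin

text \<open>
  Let the pairwise products of \<open>a, b, c, d\<close> be squares and \<open>n\<^sub>1 n\<^sub>2 = a b c d\<close> with \<open>n\<^sub>1, n\<^sub>2\<close> squares.
  Then \<open>a b + n\<^sub>2 = a b (c d + n\<^sub>1) / n\<^sub>1\<close>, so (regular) \<open>D(n\<^sub>1)\<close> implies (regular) \<open>D(n\<^sub>2)\<close>.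
  Rescale to \<open>n\<^sub>1 = 1\<close> and \<open>P\<^sup>2 = a b c d\<close> over the rationals. Then \<open>a b\<close>, \<open>a c\<close>, \<open>a d\<close> are the
  \<open>x\<close>-coordinates of points in the double of the group of \<open>y\<^sup>2 = x (x + 1) (x + P\<^sup>2)\<close>, and regularity
  holds if, for suitable signs of \<open>y\<close>, they sum to \<open>(0, 0)\<close>. Take \<open>Q\<close>, \<open>2 Q\<close>, \<open>(0, 0) - 3 Q\<close>, where \<open>Q\<close> has
  \<open>x\<close>-coordinate \<open>(f / g)\<^sup>2\<close> and \<open>P = (f / g) (h / k)\<close> for two Pythagorean triples
  \<open>f\<^sup>2 + g\<^sup>2 = s\<^sup>2\<close> and \<open>h\<^sup>2 + k\<^sup>2 = t\<^sup>2\<close>. Clearing denominators gives the polynomials below.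
  Since \<open>n\<^sub>1, n\<^sub>2\<close> are the two roots of the quadratic regularity condition, the ratio
  \<open>n\<^sub>1 / n\<^sub>2 = (g k / (f h))\<^sup>2\<close> is, up to inversion, an invariant of equivalence.
\<close>

section \<open>Regularity as a quadratic in \<open>n\<close>, and the invariant of
  equivalence\<close>

lemma is_square_iff: "is_square (x :: int) \<longleftrightarrow> (\<exists>y. x = y\<^sup>2)"
  by (auto simp: is_nth_power_def)

lemma D_quadrupleI:
  assumes "distinct [0, a, b, c, d]"
    and "is_square (a * b + n)" "is_square (a * c + n)" "is_square (a * d + n)"
    and "is_square (b * c + n)" "is_square (b * d + n)" "is_square (c * d + n)"
  shows "D_quadruple n {a, b, c, d}"
  using assms by (auto simp: D_tuple_def mult.commute)

lemma regular_D_quadrupleI: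
  assumes "D_quadruple n {a, b, c, d}" "regular_eq n a b c d"
  shows "regular_D_quadruple n {a, b, c, d}"
  using assms regular_D_quadruple_iff by blast

text \<open>Vieta's formulas for the quadratic in \<open>n\<close> of
  \<open>regular_eq_iff_sums\<close>, which has \<open>n1\<close> and \<open>n2\<close> as distinct
  roots.\<close>

lemma doubly_regular_sum_prod:
  assumes "doubly_regular A n1 n2"
  shows "4 * (n1 + n2) = 2 * (\<Sum>x\<in>A. x\<^sup>2) - (\<Sum>A)\<^sup>2" "n1 * n2 = \<Prod>A"
proof -
  let ?Q = "2 * (\<Sum>x\<in>A. x\<^sup>2) - (\<Sum>A)\<^sup>2"
  have root: "n * ?Q = 4 * (\<Prod>A + n\<^sup>2)" if reg: "regular_D_quadruple n A" for n
  proof -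
    obtain a b c d where "A = {a, b, c, d}" "regular_eq n a b c d"
      using reg unfolding regular_D_quadruple_def by blast
    moreover have "card A = 4"
      using reg by (simp add: regular_D_quadruple_def D_tuple_def)
    ultimately show ?thesis
      using regular_eq_iff_sums[of a b c d n] by simp
  qed
  have neq: "n1 \<noteq> n2" and eq: "n1 * ?Q = 4 * (\<Prod>A + n1\<^sup>2)" "n2 * ?Q = 4 * (\<Prod>A + n2\<^sup>2)"
    using assms root by (auto simp: doubly_regular_def)
  have "(n1 - n2) * ?Q = (n1 - n2) * (4 * (n1 + n2))"
    using eq by algebra
  then show sum: "4 * (n1 + n2) = ?Q"
    using neq by simp
  show "n1 * n2 = \<Prod>A"
    using eq(1) unfolding sum[symmetric] by (simp add: algebra_simps power2_eq_square)
qed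

text \<open>\<open>(n1 + n2)^2 / (n1 * n2)\<close> is unchanged under scaling by \<open>u^2\<close>
  and swapping. By Vieta it depends only on the set, so it may be computed from any admissible
  pair.\<close>

lemma equivalent_invariant:
  assumes "equivalent A n1 n2 B m1 m2"
    and "doubly_regular A n1 n2" "doubly_regular B m1 m2"
    and "doubly_regular A n1' n2'" "doubly_regular B m1' m2'"
  shows "(n1' + n2')\<^sup>2 * (m1' * m2') = (m1' + m2')\<^sup>2 * (n1' * n2')"
proof -
  obtain u :: rat where "rat_of_int m1 = rat_of_int n1 * u\<^sup>2" "rat_of_int m2 = rat_of_int n2 * u\<^sup>2"
    using assms(1) by (auto simp: equivalent_def)
  then have "(rat_of_int n1 + rat_of_int n2)\<^sup>2 * (rat_of_int m1 * rat_of_int m2) =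
    (rat_of_int m1 + rat_of_int m2)\<^sup>2 * (rat_of_int n1 * rat_of_int n2)"
    by algebra
  then have "rat_of_int ((n1 + n2)\<^sup>2 * (m1 * m2)) = rat_of_int ((m1 + m2)\<^sup>2 * (n1 * n2))"
    by simp
  then have "(n1 + n2)\<^sup>2 * (m1 * m2) = (m1 + m2)\<^sup>2 * (n1 * n2)"
    by (simp only: of_int_eq_iff)
  moreover have "n1' + n2' = n1 + n2" "n1' * n2' = n1 * n2" "m1' + m2' = m1 + m2" "m1' * m2' = m1 * m2"
    using assms(2-)[THEN doubly_regular_sum_prod(1)] assms(2-)[THEN doubly_regular_sum_prod(2)]
    by simp_all
  ultimately show ?thesis
    by simp
qed

section \<open>The quadruple attached to two Pythagorean triples\<close>

locale pythagorean_pair =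
  fixes f g s h k t :: int
  assumes fgs: "f\<^sup>2 + g\<^sup>2 = s\<^sup>2" and hkt: "h\<^sup>2 + k\<^sup>2 = t\<^sup>2"
begin

text \<open>Up to a common factor, \<open>U\<close> and \<open>-V\<close> are the polynomials of the
  tripling formula: \<open>3 Q\<close> has \<open>x\<close>-coordinate
  \<open>(f V / (g U))^2\<close>. Exchanging \<open>f, g\<close> with \<open>h, k\<close> swaps
  \<open>U\<close> and \<open>V\<close>.\<close>

definition U :: int where
  "U = 3 * f^4 * k^4 + 6 * f\<^sup>2 * h\<^sup>2 * g\<^sup>2 * k\<^sup>2 + 4 * f\<^sup>2 * g\<^sup>2 * k^4 + 4 * f^4 * h\<^sup>2 * k\<^sup>2 - h^4 * g^4"

definition V :: int where
  "V = 3 * h^4 * g^4 + 6 * f\<^sup>2 * h\<^sup>2 * g\<^sup>2 * k\<^sup>2 + 4 * h\<^sup>2 * k\<^sup>2 * g^4 + 4 * h^4 * f\<^sup>2 * g\<^sup>2 - f^4 * k^4"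

definition D :: int where
  "D = f\<^sup>2 * k\<^sup>2 - h\<^sup>2 * g\<^sup>2"

text \<open>The quotients of \<open>x1 x2\<close>, \<open>x1 x3\<close>, \<open>x1 x4\<close> by
  \<open>r1\<close> are \<open>f / g\<close>, \<open>D / (2 g k s t)\<close>,
  \<open>h U / (k V)\<close>, whose squares are the \<open>x\<close>-coordinates of
  \<open>Q\<close>, \<open>2 Q\<close>, \<open>(0, 0) - 3 Q\<close>. Moreover
  \<open>r1 r2 = x1 x2 x3 x4\<close>.\<close>

definition x1 :: int where "x1 = U * D"
definition x2 :: int where "x2 = 2 * f * s * t * k * V"
definition x3 :: int where "x3 = V * D"
definition x4 :: int where "x4 = 2 * h * s * t * g * U"
definition r1 :: int where "r1 = 2 * s * t * g * k * U * V * D"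
definition r2 :: int where "r2 = 2 * f * h * s * t * U * V * D"

lemma D_st: "D = s\<^sup>2 * k\<^sup>2 - t\<^sup>2 * g\<^sup>2" "D = f\<^sup>2 * t\<^sup>2 - h\<^sup>2 * s\<^sup>2"
  unfolding D_def using fgs hkt by algebra+

text \<open>For \<open>x\<close> the coordinate of \<open>2 Q\<close>, these make
  \<open>x + 1\<close> and \<open>x + P^2\<close> squares; both are
  \<open>(X - Y)^2 + 4 X Y = (X + Y)^2\<close>.\<close>

lemma D_sum_squares:
  "D\<^sup>2 + 4 * s\<^sup>2 * t\<^sup>2 * g\<^sup>2 * k\<^sup>2 = (s\<^sup>2 * k\<^sup>2 + t\<^sup>2 * g\<^sup>2)\<^sup>2"
  "D\<^sup>2 + 4 * f\<^sup>2 * h\<^sup>2 * s\<^sup>2 * t\<^sup>2 = (f\<^sup>2 * t\<^sup>2 + h\<^sup>2 * s\<^sup>2)\<^sup>2"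
  using D_st by algebra+

definition W :: int where
  "W = f^4 * k^4 + 4 * f\<^sup>2 * g\<^sup>2 * k^4 + 6 * f\<^sup>2 * h\<^sup>2 * g\<^sup>2 * k\<^sup>2 + 4 * h^4 * f\<^sup>2 * g\<^sup>2 + h^4 * g^4"

definition W' :: int where
  "W' = h^4 * g^4 + 4 * h\<^sup>2 * k\<^sup>2 * g^4 + 6 * f\<^sup>2 * h\<^sup>2 * g\<^sup>2 * k\<^sup>2 + 4 * f^4 * h\<^sup>2 * k\<^sup>2 + f^4 * k^4"

text \<open>These make \<open>x + 1\<close> a square at \<open>3 Q\<close> and at
  \<open>(0, 0) - 3 Q\<close>.\<close>

lemma UV_sum_squares:
  "f\<^sup>2 * V\<^sup>2 + g\<^sup>2 * U\<^sup>2 = s\<^sup>2 * W\<^sup>2"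
  "h\<^sup>2 * U\<^sup>2 + k\<^sup>2 * V\<^sup>2 = t\<^sup>2 * W'\<^sup>2"
  unfolding fgs[symmetric] hkt[symmetric] U_def V_def W_def W'_def by algebra+

lemma U_minus_V: "U - V = 4 * D * s\<^sup>2 * t\<^sup>2"
  unfolding fgs[symmetric] hkt[symmetric] U_def V_def D_def by algebra

lemma D_square_minus:
  "D\<^sup>2 - 4 * f\<^sup>2 * s\<^sup>2 * t\<^sup>2 * k\<^sup>2 = - U"
  "D\<^sup>2 - 4 * h\<^sup>2 * s\<^sup>2 * t\<^sup>2 * g\<^sup>2 = - V"
  unfolding fgs[symmetric] hkt[symmetric] U_def V_def D_def by algebra+

text \<open>The difference in the regularity equation collapses to a single product, so both sides
  of \<open>regular_eq\<close> become monomials in the same factors.\<close>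

lemma sum_diff: "x4\<^sup>2 + x3\<^sup>2 - x1\<^sup>2 - x2\<^sup>2 = 4 * s\<^sup>2 * t\<^sup>2 * U * V * D"
proof -
  have "x4\<^sup>2 + x3\<^sup>2 - x1\<^sup>2 - x2\<^sup>2 =
    V\<^sup>2 * (D\<^sup>2 - 4 * f\<^sup>2 * s\<^sup>2 * t\<^sup>2 * k\<^sup>2) - U\<^sup>2 * (D\<^sup>2 - 4 * h\<^sup>2 * s\<^sup>2 * t\<^sup>2 * g\<^sup>2)"
    unfolding x1_def x2_def x3_def x4_def by algebra
  also have "\<dots> = U * V * (U - V)"
    unfolding D_square_minus by algebra
  finally show ?thesis
    unfolding U_minus_V by algebra
qed

lemma products_r1:
  "x1\<^sup>2 * x2\<^sup>2 + r1\<^sup>2 = (2 * s\<^sup>2 * t * k * U * V * D)\<^sup>2"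
  "x1\<^sup>2 * x3\<^sup>2 + r1\<^sup>2 = (U * V * D * (s\<^sup>2 * k\<^sup>2 + t\<^sup>2 * g\<^sup>2))\<^sup>2"
  "x1\<^sup>2 * x4\<^sup>2 + r1\<^sup>2 = (2 * s * t\<^sup>2 * g * U * D * W')\<^sup>2"
  "x2\<^sup>2 * x3\<^sup>2 + r1\<^sup>2 = (2 * s\<^sup>2 * t * k * V * D * W)\<^sup>2"
  "x2\<^sup>2 * x4\<^sup>2 + r1\<^sup>2 = (2 * s * t * g * k * U * V * (f\<^sup>2 * t\<^sup>2 + h\<^sup>2 * s\<^sup>2))\<^sup>2"
  "x3\<^sup>2 * x4\<^sup>2 + r1\<^sup>2 = (2 * s * t\<^sup>2 * g * U * V * D)\<^sup>2"
  unfolding x1_def x2_def x3_def x4_def r1_def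
  using fgs hkt D_sum_squares UV_sum_squares by algebra+

lemma products_r2:
  "x1\<^sup>2 * x2\<^sup>2 + r2\<^sup>2 = (2 * f * s * t\<^sup>2 * U * V * D)\<^sup>2"
  "x1\<^sup>2 * x3\<^sup>2 + r2\<^sup>2 = (U * V * D * (f\<^sup>2 * t\<^sup>2 + h\<^sup>2 * s\<^sup>2))\<^sup>2"
  "x1\<^sup>2 * x4\<^sup>2 + r2\<^sup>2 = (2 * h * s\<^sup>2 * t * U * D * W)\<^sup>2"
  "x2\<^sup>2 * x3\<^sup>2 + r2\<^sup>2 = (2 * f * s * t\<^sup>2 * V * D * W')\<^sup>2"
  "x2\<^sup>2 * x4\<^sup>2 + r2\<^sup>2 = (2 * f * h * s * t * U * V * (s\<^sup>2 * k\<^sup>2 + t\<^sup>2 * g\<^sup>2))\<^sup>2"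
  "x3\<^sup>2 * x4\<^sup>2 + r2\<^sup>2 = (2 * h * s\<^sup>2 * t * U * V * D)\<^sup>2"
  unfolding x1_def x2_def x3_def x4_def r2_def
  using fgs hkt D_sum_squares UV_sum_squares by algebra+

lemma regular_eq_r1: "regular_eq (r1\<^sup>2) (x1\<^sup>2) (x2\<^sup>2) (x3\<^sup>2) (x4\<^sup>2)"
  unfolding regular_eq_def sum_diff products_r1 unfolding r1_def by algebra

lemma regular_eq_r2: "regular_eq (r2\<^sup>2) (x1\<^sup>2) (x2\<^sup>2) (x3\<^sup>2) (x4\<^sup>2)"
  unfolding regular_eq_def sum_diff products_r2 unfolding r2_def by algebra

definition quad :: "int set" where
  "quad = {x1\<^sup>2, x2\<^sup>2, x3\<^sup>2, x4\<^sup>2}"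

lemma quad_D0:
  assumes "distinct [0, x1\<^sup>2, x2\<^sup>2, x3\<^sup>2, x4\<^sup>2]"
  shows "D_quadruple 0 quad"
  unfolding quad_def
  by (rule D_quadrupleI[OF assms]) (auto simp: is_square_iff power_mult_distrib[symmetric])

lemma quad_doubly_regular:
  assumes dist: "distinct [0, x1\<^sup>2, x2\<^sup>2, x3\<^sup>2, x4\<^sup>2]" and neq: "(g * k)\<^sup>2 \<noteq> (f * h)\<^sup>2"
  shows "doubly_regular quad (r1\<^sup>2) (r2\<^sup>2)"
proof -
  define c where "c = 2 * s * t * U * V * D"
  have r: "r1 = g * k * c" "r2 = f * h * c"
    by (simp_all add: r1_def r2_def c_def)
  have "x1 \<noteq> 0" "x2 \<noteq> 0" "x3 \<noteq> 0" "x4 \<noteq> 0"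
    using dist by auto
  then have "c \<noteq> 0" "r1 \<noteq> 0" "r2 \<noteq> 0"
    by (auto simp: x1_def x2_def x3_def x4_def r c_def)
  moreover from this neq have "r1\<^sup>2 \<noteq> r2\<^sup>2"
    by (simp add: r power_mult_distrib)
  moreover have "regular_D_quadruple (r1\<^sup>2) quad" "regular_D_quadruple (r2\<^sup>2) quad"
    unfolding quad_def
    by (intro regular_D_quadrupleI D_quadrupleI dist regular_eq_r1 regular_eq_r2;
        simp only: is_square_iff products_r1 products_r2; blast)+
  ultimately show ?thesis
    by (auto simp: doubly_regular_def is_square_iff)
qed

end

section \<open>A one-parameter family of nonequivalent quadruples\<close>

lemma pythagorean_pair_cong:
  fixes m :: int
  assumes "pythagorean_pair f g s h k t" "pythagorean_pair f' g' s' h k t"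
    and "[f = f'] (mod m)" "[g = g'] (mod m)" "[s = s'] (mod m)"
  shows "[pythagorean_pair.x1 f g h k = pythagorean_pair.x1 f' g' h k] (mod m)"
    and "[pythagorean_pair.x2 f g s h k t = pythagorean_pair.x2 f' g' s' h k t] (mod m)"
    and "[pythagorean_pair.x3 f g h k = pythagorean_pair.x3 f' g' h k] (mod m)"
    and "[pythagorean_pair.x4 f g s h k t = pythagorean_pair.x4 f' g' s' h k t] (mod m)"
proof -
  interpret P: pythagorean_pair f g s h k t by fact
  interpret Q: pythagorean_pair f' g' s' h k t by fact
  note intros = cong_add cong_diff cong_mult cong_pow cong_refl
  have UVD: "[P.U = Q.U] (mod m)" "[P.V = Q.V] (mod m)" "[P.D = Q.D] (mod m)"
    unfolding P.U_def Q.U_def P.V_def Q.V_def P.D_def Q.D_def by (intro intros assms)+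
  show "[P.x1 = Q.x1] (mod m)" "[P.x2 = Q.x2] (mod m)" "[P.x3 = Q.x3] (mod m)" "[P.x4 = Q.x4] (mod m)"
    unfolding P.x1_def Q.x1_def P.x2_def Q.x2_def P.x3_def Q.x3_def P.x4_def Q.x4_def
    by (intro intros assms UVD)+
qed

lemma pythagorean_pair_family: "pythagorean_pair (2 * j) (j\<^sup>2 - 1) (j\<^sup>2 + 1) 3 4 5"
  by unfold_locales algebra+

text \<open>In the family \<open>f h = 6 j\<close> and \<open>g k = 4 (j^2 - 1)\<close>, so this
  separates \<open>r1^2\<close> from \<open>r2^2\<close> and fixes which is larger.\<close>

lemma mult_6_less:
  fixes j :: int
  assumes "j > 3"
  shows "6 * j < 4 * (j\<^sup>2 - 1)"
proof -
  \<comment> \<open>Taylor expansion at 3, with all coefficients positive.\<close>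
  have "4 * (j\<^sup>2 - 1) - 6 * j = 4 * (j - 3)\<^sup>2 + 18 * (j - 3) + 14"
    by algebra
  also have "\<dots> > 0"
    using assms by (intro add_nonneg_pos add_nonneg_nonneg) simp_all
  finally show ?thesis
    by simp
qed

definition quad_family :: "int \<Rightarrow> int set" where
  "quad_family j = pythagorean_pair.quad (2 * j) (j\<^sup>2 - 1) (j\<^sup>2 + 1) 3 4 5"

text \<open>The congruence condition makes distinctness a computation modulo 23 at \<open>j = 11\<close>.\<close>

lemma
  assumes j: "[j = 11] (mod 23)" "j > 3"
  shows quad_family_D0: "D_quadruple 0 (quad_family j)"
    and quad_family_squares: "\<forall>a\<in>quad_family j. is_square a"
    and quad_family_doubly_regular: "\<exists>c. c \<noteq> 0 \<and>
      doubly_regular (quad_family j) ((4 * (j\<^sup>2 - 1) * c)\<^sup>2) ((6 * j * c)\<^sup>2)"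
proof -
  interpret pythagorean_pair "2 * j" "j\<^sup>2 - 1" "j\<^sup>2 + 1" 3 4 5
    by (rule pythagorean_pair_family)
  interpret Q: pythagorean_pair "2 * 11" "11\<^sup>2 - 1" "11\<^sup>2 + 1" 3 4 5
    by (rule pythagorean_pair_family)
  have fgs: "[2 * j = 2 * 11] (mod 23)" "[j\<^sup>2 - 1 = 11\<^sup>2 - 1] (mod 23)" "[j\<^sup>2 + 1 = 11\<^sup>2 + 1] (mod 23)"
    by (intro cong_add cong_diff cong_mult cong_pow cong_refl j)+
  note cong = pythagorean_pair_cong[OF pythagorean_pair_family pythagorean_pair_family fgs]
  have "x1\<^sup>2 mod 23 = Q.x1\<^sup>2 mod 23" "x2\<^sup>2 mod 23 = Q.x2\<^sup>2 mod 23"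
    "x3\<^sup>2 mod 23 = Q.x3\<^sup>2 mod 23" "x4\<^sup>2 mod 23 = Q.x4\<^sup>2 mod 23"
    using cong[THEN cong_pow[where n = 2]] by (simp_all only: cong_def)
  moreover have "Q.x1\<^sup>2 mod 23 = 1" "Q.x2\<^sup>2 mod 23 = 8" "Q.x3\<^sup>2 mod 23 = 2" "Q.x4\<^sup>2 mod 23 = 16"
    unfolding Q.x1_def Q.x2_def Q.x3_def Q.x4_def Q.U_def Q.V_def Q.D_def by simp_all
  ultimately have "x1\<^sup>2 mod 23 = 1" "x2\<^sup>2 mod 23 = 8" "x3\<^sup>2 mod 23 = 2" "x4\<^sup>2 mod 23 = 16"
    by (simp_all only:)
  then have "distinct (map (\<lambda>x. x mod 23) [0, x1\<^sup>2, x2\<^sup>2, x3\<^sup>2, x4\<^sup>2])"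
    by (simp only: list.map) simp
  then have dist: "distinct [0, x1\<^sup>2, x2\<^sup>2, x3\<^sup>2, x4\<^sup>2]"
    by (simp only: distinct_map)
  show "D_quadruple 0 (quad_family j)"
    unfolding quad_family_def by (rule quad_D0[OF dist])
  show "\<forall>a\<in>quad_family j. is_square a"
    by (auto simp: quad_family_def quad_def is_square_iff)
  have "2 * j * 3 < (j\<^sup>2 - 1) * 4"
    using mult_6_less[OF j(2)] by simp
  then have "(2 * j * 3)\<^sup>2 < ((j\<^sup>2 - 1) * 4)\<^sup>2"
    using j(2) by (intro power_strict_mono) auto
  then have reg: "doubly_regular quad (r1\<^sup>2) (r2\<^sup>2)"
    by (intro quad_doubly_regular dist) simp
  define c where "c = 2 * (j\<^sup>2 + 1) * 5 * U * V * D"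
  have r: "r1 = 4 * (j\<^sup>2 - 1) * c" "r2 = 6 * j * c"
    by (simp_all add: r1_def r2_def c_def)
  moreover have "c \<noteq> 0"
    using reg r by (auto simp: doubly_regular_def)
  ultimately show "\<exists>c. c \<noteq> 0 \<and> doubly_regular (quad_family j) ((4 * (j\<^sup>2 - 1) * c)\<^sup>2) ((6 * j * c)\<^sup>2)"
    using reg unfolding quad_family_def by metis
qed

text \<open>The invariant determines \<open>R / F\<close> up to inversion, and \<open>R > F\<close>
  excludes inversion. Here \<open>R / F = (2/3) (j - 1/j)\<close> is injective for positive
  \<open>j\<close>.\<close>

lemma quad_family_nonequivalent:
  assumes "[i = 11] (mod 23)" "i > 3" "[j = 11] (mod 23)" "j > 3"
    and "doubly_regular (quad_family i) n1 n2" "doubly_regular (quad_family j) m1 m2"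
    and "equivalent (quad_family i) n1 n2 (quad_family j) m1 m2"
  shows "i = j"
proof -
  obtain c d where c: "c \<noteq> 0" "doubly_regular (quad_family i) ((4 * (i\<^sup>2 - 1) * c)\<^sup>2) ((6 * i * c)\<^sup>2)"
    and d: "d \<noteq> 0" "doubly_regular (quad_family j) ((4 * (j\<^sup>2 - 1) * d)\<^sup>2) ((6 * j * d)\<^sup>2)"
    using quad_family_doubly_regular assms(1-4) by metis
  define R F R' F' where defs: "R = 4 * (i\<^sup>2 - 1)" "F = 6 * i" "R' = 4 * (j\<^sup>2 - 1)" "F' = 6 * j"
  have less: "0 < F" "F < R" "0 < F'" "F' < R'"
    using assms(2,4) mult_6_less[of i] mult_6_less[of j] by (simp_all add: defs)
  have factor: "((p * c)\<^sup>2 + (q * c)\<^sup>2)\<^sup>2 * ((p' * d)\<^sup>2 * (q' * d)\<^sup>2) =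
      (c * d)^4 * ((p\<^sup>2 + q\<^sup>2) * (p' * q'))\<^sup>2" for p q p' q' c d :: int
    by (simp add: power_mult_distrib flip: distrib_right)
  have "((R * c)\<^sup>2 + (F * c)\<^sup>2)\<^sup>2 * ((R' * d)\<^sup>2 * (F' * d)\<^sup>2) =
      ((R' * d)\<^sup>2 + (F' * d)\<^sup>2)\<^sup>2 * ((R * c)\<^sup>2 * (F * c)\<^sup>2)"
    using equivalent_invariant[OF assms(7,5,6) c(2) d(2)] unfolding defs .
  then have "(c * d)^4 * ((R\<^sup>2 + F\<^sup>2) * (R' * F'))\<^sup>2 = (c * d)^4 * ((R'\<^sup>2 + F'\<^sup>2) * (R * F))\<^sup>2"
    unfolding factor by (simp add: ac_simps)
  then have "((R\<^sup>2 + F\<^sup>2) * (R' * F'))\<^sup>2 = ((R'\<^sup>2 + F'\<^sup>2) * (R * F))\<^sup>2"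
    using c(1) d(1) by simp
  then have "(R\<^sup>2 + F\<^sup>2) * (R' * F') = (R'\<^sup>2 + F'\<^sup>2) * (R * F)"
    using less by (subst (asm) power2_eq_iff_nonneg) auto
  \<comment> \<open>The factors correspond to \<open>R / F = R' / F'\<close> and to the inverted
    case \<open>R / F = F' / R'\<close>.\<close>
  then have "(R * F' - R' * F) * (R * R' - F * F') = 0"
    by algebra
  moreover have "F * F' < R * R'"
    using less by (intro mult_strict_mono) auto
  ultimately have "R * F' = R' * F"
    by simp
  then have "24 * ((i - j) * (i * j + 1)) = 0"
    unfolding defs by algebra
  moreover have "0 < i * j"
    using assms(2,4) by simp
  ultimately show ?thesis
    by auto
qed

theorem theorem1:
  "(\<exists>S :: int set set.
      infinite S \<and> pairwise_nonequivalent S \<and> (\<forall>A\<in>S. \<exists>n1 n2. doubly_regular A n1 n2)) \<and>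
   (\<exists>S :: int set set.
      infinite S \<and> pairwise_nonequivalent S \<and> (\<forall>A\<in>S. \<exists>n1 n2. doubly_regular A n1 n2) \<and>
      (\<forall>A\<in>S. (\<forall>a\<in>A. is_square a) \<and> D_quadruple 0 A))"
proof -
  define J :: "int set" where "J = (\<lambda>i. 11 + 23 * int i) ` UNIV"
  have J: "[j = 11] (mod 23)" "j > 3" if "j \<in> J" for j
    using that by (auto simp: J_def cong_def)
  have "infinite J"
    unfolding J_def by (auto dest!: finite_imageD simp: inj_on_def)
  moreover have "inj_on quad_family J"
  proof (rule inj_onI)
    fix i j assume ij: "i \<in> J" "j \<in> J" and eq: "quad_family i = quad_family j"
    obtain n1 n2 where reg: "doubly_regular (quad_family i) n1 n2"
      using quad_family_doubly_regular J ij by metis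
    \<comment> \<open>Equal quadruples are equivalent via \<open>u = 1\<close>, so nonequivalence
      also yields injectivity.\<close>
    then have "equivalent (quad_family i) n1 n2 (quad_family j) n1 n2"
      unfolding equivalent_def eq
      by (auto simp: doubly_regular_def regular_D_quadruple_def intro!: exI[of _ 1])
    then show "i = j"
      using quad_family_nonequivalent J ij reg eq by metis
  qed
  ultimately have "infinite (quad_family ` J)"
    using finite_imageD by blast
  moreover have "pairwise_nonequivalent (quad_family ` J)"
    unfolding pairwise_nonequivalent_def using quad_family_nonequivalent J by blast
  moreover have "\<forall>A\<in>quad_family ` J. \<exists>n1 n2. doubly_regular A n1 n2"
    using quad_family_doubly_regular J by blast
  moreover have "\<forall>A\<in>quad_family ` J. (\<forall>a\<in>A. is_square a) \<and> D_quadruple 0 A"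
    using quad_family_squares quad_family_D0 J by blast
  ultimately show ?thesis
    by blast
qed

end
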